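(* Let $A\in\mathbb{R}^{m\times n}$, $A\neq 0$, and $C\in\mathbb{R}^{p\times n}$ be such that the matrix equation $XA=C$ is consistent (i.e. it has a solution $X\in\mathbb{R}^{p\times m}$). Let $X^{(0)}\in\mathbb{R}^{p\times m}$ be arbitrary and let $\{X^{(k)}\}_{k\ge 0}$ be generated by the randomized Kaczmarz iteration $$X^{(k+1)}=X^{(k)}+\frac{C_{:,j}-X^{(k)}A_{:,j}}{\|A_{:,j}\|_2^2}(A_{:,j})^T,\qquad k\ge 0,$$ where at each iteration the column index $j\in\{1,\dots,n\}$ is selected at random with probability $\|A_{:,j}\|_2^2/\|A\|_F^2$. Then $\{X^{(k)}\}$ converges linearly in mean square to $X^*=CA^++X^{(0)}(I_m-AA^+)$, and for all $k\ge 0$ $$E\bigl[\|X^{(k)}-X^*\|_F^2\bigr]\le\left(1-\frac{\sigma_{\min}^2(A)}{\|A\|_F^2}\right)^k\|X^{(0)}-X^*\|_F^2 .$$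
   Context: $A_{:,j}$ denotes the $j$th column of $A$, $A^+$ the Moore-Penrose inverse, $\|\cdot\|_F$ the Frobenius norm, $\sigma_{\min}(A)$ the smallest nonzero singular value of $A$, and $I_m$ the $m\times m$ identity. The index selections at different iterations are independent; zero columns have probability zero and are never selected. "Converges linearly in mean square to $X^*$" means that $E[\|X^{(k)}-X^*\|_F^2]\to 0$ at a geometric rate (bounded by $c\,q^k$ for some $c\ge 0$ and $q\in[0,1)$). *)

theory Defs
  imports "HOL-Analysis.Analysis" "HOL-Probability.Probability"
begin

text \<open>
  A real matrix with rows indexed by \<open>'m\<close> and columns indexed by \<open>'n\<close> has type \<open>real ^ 'n ^ 'm\<close>.
  On this type the library norm is the Frobenius norm (not the operator norm):
\<close>

lemma norm_matrix_eq_frobenius: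
  fixes A :: "real ^ 'n ^ 'm"
  shows "norm A = sqrt (\<Sum>i\<in>UNIV. \<Sum>j\<in>UNIV. (A $ i $ j)\<^sup>2)"
  by (simp add: norm_vec_def L2_set_def sum_nonneg)

text \<open>The Moore-Penrose inverse: the unique matrix satisfying the four Penrose equations.\<close>

definition is_moore_penrose_inverse :: "real ^ 'n ^ 'm \<Rightarrow> real ^ 'm ^ 'n \<Rightarrow> bool" where
  "is_moore_penrose_inverse A P \<longleftrightarrow>
     A ** P ** A = A \<and> P ** A ** P = P \<and>
     transpose (A ** P) = A ** P \<and> transpose (P ** A) = P ** A"

definition moore_penrose_inverse :: "real ^ 'n ^ 'm \<Rightarrow> real ^ 'm ^ 'n" where
  "moore_penrose_inverse A = (THE P. is_moore_penrose_inverse A P)"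

text \<open>
  Singular values are the nonnegative square roots of the eigenvalues of \<open>A\<^sup>T A\<close>. (Using
  \<open>A A\<^sup>T\<close> instead could only change whether \<open>0\<close> counts as a singular value.)
\<close>

definition singular_value :: "real ^ 'n ^ 'm \<Rightarrow> real \<Rightarrow> bool" where
  "singular_value A s \<longleftrightarrow> s \<ge> 0 \<and> (\<exists>v. v \<noteq> 0 \<and> (transpose A ** A) *v v = s\<^sup>2 *\<^sub>R v)"

definition sigma_min :: "real ^ 'n ^ 'm \<Rightarrow> real" where
  "sigma_min A = (LEAST s. singular_value A s \<and> s \<noteq> 0)"

definition outer_product :: "real ^ 'p \<Rightarrow> real ^ 'm \<Rightarrow> real ^ 'm ^ 'p" where
  "outer_product u v = (\<chi> i l. u $ i * v $ l)"

text \<open>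
  If column \<open>j\<close> of \<open>A\<close> is zero, the division by zero is harmless: the step leaves \<open>X\<close> unchanged.
\<close>

definition kaczmarz_step ::
  "real ^ 'n ^ 'm \<Rightarrow> real ^ 'n ^ 'p \<Rightarrow> 'n \<Rightarrow> real ^ 'm ^ 'p \<Rightarrow> real ^ 'm ^ 'p" where
  "kaczmarz_step A C j X =
     X + outer_product ((column j C - X *v column j A) /\<^sub>R (norm (column j A))\<^sup>2) (column j A)"

text \<open>
  Integrability is demanded explicitly, since the Bochner integral of a non-integrable function
  is \<open>0\<close> by convention.
\<close>

definition converges_linearly_in_mean_square ::
  "'w measure \<Rightarrow> (nat \<Rightarrow> 'w \<Rightarrow> real ^ 'm ^ 'p) \<Rightarrow> real ^ 'm ^ 'p \<Rightarrow> bool" where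
  "converges_linearly_in_mean_square M X L \<longleftrightarrow>
     (\<forall>k. integrable M (\<lambda>\<omega>. (norm (X k \<omega> - L))\<^sup>2)) \<and>
     (\<exists>c q. 0 \<le> c \<and> 0 \<le> q \<and> q < 1 \<and>
        (\<forall>k. (LINT \<omega>|M. (norm (X k \<omega> - L))\<^sup>2) \<le> c * q ^ k))"

end

theory Submission
  imports Defs
begin

text \<open>
  Since \<open>X\<^sup>* A = C\<close>, one step replaces every row of the error \<open>X - X\<^sup>*\<close> by its projection onto the
  orthogonal complement of the selected column \<open>a\<close>, so the squared error drops by
  \<open>\<parallel>(X - X\<^sup>*) a\<parallel>\<^sup>2 / \<parallel>a\<parallel>\<^sup>2\<close>. Averaging over the column turns this into
  \<open>\<parallel>(X - X\<^sup>*) A\<parallel>\<^sup>2 / \<parallel>A\<parallel>\<^sup>2\<close>, which is at least \<open>\<sigma>\<^sub>m\<^sub>i\<^sub>n\<^sup>2 / \<parallel>A\<parallel>\<^sup>2\<close> times the squared error because the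
  rows of the error never leave the column space of \<open>A\<close>. The choice of \<open>X\<^sup>*\<close> ensures that they start there.
\<close>

section \<open>The Moore-Penrose inverse\<close>

lemma matrix_diff_ldistrib: "(A :: real ^ 'n ^ 'm) ** (B - C) = A ** B - A ** C"
  by (simp add: matrix_matrix_mult_def vec_eq_iff right_diff_distrib sum_subtractf)

lemma matrix_diff_rdistrib: "(B - C) ** (A :: real ^ 'n ^ 'm) = B ** A - C ** A"
  by (simp add: matrix_matrix_mult_def vec_eq_iff left_diff_distrib sum_subtractf)

lemma matrix_add_rdistrib: "(B + C) ** (A :: real ^ 'n ^ 'm) = B ** A + C ** A"
  by (simp add: matrix_matrix_mult_def vec_eq_iff distrib_right sum.distrib)

text \<open>\<open>A ** P\<close> and \<open>A ** Q\<close> are both the orthogonal projection onto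
  the column space of \<open>A\<close>, hence equal; likewise \<open>P ** A = Q ** A\<close>. Then
  \<open>P ** A ** P = P ** A ** Q = Q ** A ** Q\<close>.\<close>

lemma moore_penrose_inverse_unique:
  assumes P: "is_moore_penrose_inverse A P" and Q: "is_moore_penrose_inverse A Q"
  shows "P = Q"
proof -
  note eqs = P[unfolded is_moore_penrose_inverse_def] Q[unfolded is_moore_penrose_inverse_def]
  have "A ** P = transpose ((A ** Q ** A) ** P)"
    using eqs by simp
  also have "\<dots> = transpose ((A ** Q) ** (A ** P))"
    by (simp add: matrix_mul_assoc)
  also have "\<dots> = (A ** P) ** (A ** Q)"
    using eqs by (simp only: matrix_transpose_mul[of "A ** Q" "A ** P"])
  also have "\<dots> = A ** Q"
    using eqs by (simp add: matrix_mul_assoc)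
  finally have AP: "A ** P = A ** Q" .
  have "P ** A = transpose (P ** (A ** Q ** A))"
    using eqs by simp
  also have "\<dots> = transpose ((P ** A) ** (Q ** A))"
    by (simp add: matrix_mul_assoc)
  also have "\<dots> = (Q ** A) ** (P ** A)"
    using eqs by (simp only: matrix_transpose_mul[of "P ** A" "Q ** A"])
  also have "\<dots> = Q ** (A ** P ** A)"
    by (simp add: matrix_mul_assoc)
  finally have PA: "P ** A = Q ** A"
    using eqs by simp
  have "P = P ** (A ** P)"
    using eqs by (simp add: matrix_mul_assoc)
  also have "\<dots> = P ** A ** Q"
    by (simp add: AP matrix_mul_assoc)
  also have "\<dots> = Q"
    using eqs by (simp add: PA)
  finally show ?thesis .
qed

lemma inner_transpose_mult:
  fixes A :: "real ^ 'n ^ 'm"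
  shows "(transpose A *v y) \<bullet> x = y \<bullet> (A *v x)"
  by (metis dot_lmul_matrix transpose_matrix_vector)

lemma subspace_range_matrix: "subspace (range ((*v) (A :: real ^ 'n ^ 'm)))"
  by (intro linear_subspace_image matrix_vector_mul_linear subspace_UNIV)

text \<open>Any preimage under \<open>A\<close> of the orthogonal projection of \<open>y\<close>
  onto the column space works, since \<open>transpose A\<close> annihilates the residual.\<close>

lemma normal_equation_solvable:
  fixes A :: "real ^ 'n ^ 'm"
  shows "\<exists>x. transpose A *v (A *v x) = transpose A *v y"
proof -
  obtain p q where p: "p \<in> span (range ((*v) A))"
    and q: "\<And>w. w \<in> span (range ((*v) A)) \<Longrightarrow> orthogonal q w" and y: "y = p + q"
    using orthogonal_subspace_decomp_exists by blast
  obtain x where x: "p = A *v x"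
    using p by (auto simp: span_eq_iff[THEN iffD2, OF subspace_range_matrix])
  have "(transpose A *v q) \<bullet> (transpose A *v q) = 0"
    using q[of "A *v (transpose A *v q)"]
    by (simp only: inner_transpose_mult) (simp add: orthogonal_def span_base)
  then have "transpose A *v y = transpose A *v (A *v x)"
    by (simp add: y x matrix_vector_right_distrib)
  then show ?thesis by metis
qed

text \<open>The columns of \<open>B\<close> are least-squares solutions for the unit vectors, so
  \<open>transpose A ** A ** B = transpose A\<close>; both claims follow from this identity.\<close>

lemma least_squares_inverse_exists:
  fixes A :: "real ^ 'n ^ 'm"
  shows "\<exists>B. A ** B ** A = A \<and> transpose (A ** B) = A ** B"
proof -
  obtain f where f: "\<And>y. transpose A *v (A *v f y) = transpose A *v y"
    using normal_equation_solvable by metis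
  define B :: "real ^ 'm ^ 'n" where "B = (\<chi> i j. f (axis j 1) $ i)"
  have col: "column j B = f (axis j 1)" for j
    by (simp add: B_def column_def vec_eq_iff)
  have "B *v axis j 1 = f (axis j 1)" for j
    by (simp only: matrix_vector_mult_basis col)
  then have "(transpose A ** A ** B) *v axis j 1 = transpose A *v axis j 1" for j
    by (simp only: f flip: matrix_vector_mul_assoc)
  then have "column j (transpose A ** A ** B) = column j (transpose A)" for j
    by (simp only: matrix_vector_mult_basis)
  then have AAB: "transpose A ** A ** B = transpose A"
    by (simp add: vec_eq_iff column_def)
  \<comment> \<open>The Gram matrix on the left is symmetric, so its equality with
    \<open>transpose (A ** B)\<close> makes \<open>A ** B\<close> symmetric.\<close>
  have "transpose (A ** B) ** (A ** B) = transpose B ** (transpose A ** A ** B)"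
    by (simp only: matrix_transpose_mul matrix_mul_assoc)
  also have "\<dots> = transpose (A ** B)"
    by (simp only: AAB matrix_transpose_mul)
  finally have AB: "transpose (A ** B) ** (A ** B) = transpose (A ** B)" .
  have "A ** B = transpose (transpose (A ** B) ** (A ** B))"
    by (simp only: AB transpose_transpose)
  also have "\<dots> = transpose (A ** B)"
    unfolding matrix_transpose_mul[of "transpose (A ** B)"] transpose_transpose by (rule AB)
  finally have sym: "transpose (A ** B) = A ** B" by (rule sym)
  have "A ** B ** A = transpose (A ** B) ** A"
    by (simp only: sym)
  also have "\<dots> = transpose (transpose A ** A ** B)"
    by (simp only: matrix_transpose_mul transpose_transpose matrix_mul_assoc)
  also have "\<dots> = A"
    by (simp only: AAB transpose_transpose)
  finally show ?thesis
    using sym by blast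
qed

text \<open>Transposing a least-squares inverse of \<open>transpose A\<close> gives \<open>D\<close>
  with \<open>D ** A\<close> symmetric, while \<open>B\<close> has \<open>A ** B\<close> symmetric.
  The product \<open>D ** A ** B\<close> inherits both: multiplied by \<open>A\<close> it gives
  \<open>A ** B\<close> on one side and \<open>D ** A\<close> on the other.\<close>

lemma moore_penrose_inverse_exists: "\<exists>P. is_moore_penrose_inverse A P"
proof -
  obtain B where B: "A ** B ** A = A" "transpose (A ** B) = A ** B"
    using least_squares_inverse_exists by blast
  obtain D' where D': "transpose A ** D' ** transpose A = transpose A"
      "transpose (transpose A ** D') = transpose A ** D'"
    using least_squares_inverse_exists by blast
  define D where "D = transpose D'"
  have D: "A ** D ** A = A" "transpose (D ** A) = D ** A"
    using arg_cong[OF D'(1), of transpose] D'(2)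
    by (simp_all add: D_def matrix_transpose_mul matrix_mul_assoc)
  have "A ** (D ** A ** B) = A ** D ** A ** B" "D ** A ** B ** A = D ** (A ** B ** A)"
    "D ** A ** B ** A ** (D ** A ** B) = D ** (A ** B ** A) ** D ** A ** B"
    "D ** A ** D ** A ** B = D ** (A ** D ** A) ** B"
    by (simp_all only: matrix_mul_assoc)
  then have "is_moore_penrose_inverse A (D ** A ** B)"
    unfolding is_moore_penrose_inverse_def by (simp only: B D simp_thms)
  then show ?thesis ..
qed

lemma is_moore_penrose_inverse:
  "is_moore_penrose_inverse A (moore_penrose_inverse A)"
  unfolding moore_penrose_inverse_def
  by (rule theI') (use moore_penrose_inverse_exists moore_penrose_inverse_unique in blast)

section \<open>The smallest nonzero singular value\<close>

lemma norm_matrix_eq_sum_rows: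
  "(norm (A :: real ^ 'n ^ 'm))\<^sup>2 = (\<Sum>i\<in>UNIV. (norm (A $ i))\<^sup>2)"
  by (simp add: norm_vec_def L2_set_def sum_nonneg)

lemma norm_matrix_eq_sum_columns:
  "(norm (A :: real ^ 'n ^ 'm))\<^sup>2 = (\<Sum>j\<in>UNIV. (norm (column j A))\<^sup>2)"
proof -
  have "(norm A)\<^sup>2 = (\<Sum>i\<in>UNIV. \<Sum>j\<in>UNIV. (A $ i $ j)\<^sup>2)"
    by (simp add: norm_matrix_eq_frobenius sum_nonneg)
  also have "\<dots> = (\<Sum>j\<in>UNIV. (norm (column j A))\<^sup>2)"
    by (subst sum.swap) (simp add: norm_vec_def L2_set_def sum_nonneg column_def)
  finally show ?thesis .
qed

lemma norm_transpose_mult: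
  "(norm (transpose A *v u))\<^sup>2 = (\<Sum>j\<in>UNIV. (column j (A :: real ^ 'n ^ 'm) \<bullet> u)\<^sup>2)"
  unfolding power2_norm_eq_inner
  by (simp add: inner_vec_def power2_eq_square matrix_vector_mult_def transpose_def column_def)

text \<open>The first-order condition for a quadratic with minimum 0 at \<open>t = 0\<close>, in a
  form free of derivatives.\<close>

lemma linear_coefficient_eq_0:
  fixes b c :: real
  assumes "\<And>t. 0 \<le> t * b + t\<^sup>2 * c"
  shows "b = 0"
proof (rule ccontr)
  assume "b \<noteq> 0"
  \<comment> \<open>\<open>d\<close> is positive and exceeds \<open>c\<close> whatever the sign of
    \<open>c\<close>, so at \<open>t = - b / d\<close> the linear term dominates.\<close>
  define d where "d = \<bar>c\<bar> + 1"
  have d: "d > 0" "c < d" by (auto simp: d_def)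
  have "(- b / d) * b + (- b / d)\<^sup>2 * c = b\<^sup>2 / d\<^sup>2 * (c - d)"
    using d by (simp add: field_simps power2_eq_square)
  also have "\<dots> < 0"
    using d \<open>b \<noteq> 0\<close> by (intro mult_pos_neg) auto
  finally show False using assms[of "- b / d"] by simp
qed

text \<open>A minimiser of the Rayleigh quotient of \<open>A A\<^sup>T\<close> on the column space of \<open>A\<close> is an eigenvector
  of \<open>A A\<^sup>T\<close>; this makes the full spectral theorem unnecessary.\<close>

lemma rayleigh_minimiser_exists:
  fixes A :: "real ^ 'n ^ 'm"
  assumes "A \<noteq> 0"
  obtains u l where "u \<in> range ((*v) A)" "norm u = 1" "l > 0"
    "A *v (transpose A *v u) = l *\<^sub>R u" "(norm (transpose A *v u))\<^sup>2 = l"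
    "\<And>w. w \<in> range ((*v) A) \<Longrightarrow> l * (norm w)\<^sup>2 \<le> (norm (transpose A *v w))\<^sup>2"
proof -
  let ?V = "range ((*v) A)" and ?T = "transpose A"
  note V = subspace_range_matrix[of A]
  have "compact (sphere 0 1 \<inter> ?V)"
    by (intro compact_Int_closed closed_subspace V) auto
  moreover obtain v where v: "A *v v \<noteq> 0"
    using assms by (metis matrix_eq matrix_vector_mult_0)
  have "(1 / norm (A *v v)) *\<^sub>R (A *v v) \<in> sphere 0 1 \<inter> ?V"
    using v by (auto intro!: subspace_scale[OF V])
  then have "sphere 0 1 \<inter> ?V \<noteq> {}" by blast
  moreover have "continuous_on (sphere 0 1 \<inter> ?V) (\<lambda>u. (norm (?T *v u))\<^sup>2)"
    by (intro continuous_intros linear_continuous_on_compose[OF continuous_on_id]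
        matrix_vector_mul_linear)
  ultimately obtain u where u: "u \<in> sphere 0 1 \<inter> ?V"
    and min: "\<And>w. w \<in> sphere 0 1 \<inter> ?V \<Longrightarrow> (norm (?T *v u))\<^sup>2 \<le> (norm (?T *v w))\<^sup>2"
    using continuous_attains_inf[of "sphere 0 1 \<inter> ?V" "\<lambda>u. (norm (?T *v u))\<^sup>2"] by blast
  define l where "l = (norm (?T *v u))\<^sup>2"
  have uV: "u \<in> ?V" and u1: "norm u = 1" using u by auto
  have bound: "l * (norm w)\<^sup>2 \<le> (norm (?T *v w))\<^sup>2" if w: "w \<in> ?V" for w
  proof (cases "w = 0")
    case False
    have "l \<le> (norm (?T *v ((1 / norm w) *\<^sub>R w)))\<^sup>2"
      unfolding l_def using w False by (intro min) (auto intro!: subspace_scale[OF V])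
    also have "\<dots> = (norm (?T *v w))\<^sup>2 / (norm w)\<^sup>2"
      by (simp add: matrix_vector_mult_scaleR power_divide)
    finally show ?thesis using False by (simp add: field_simps)
  qed simp
  \<comment> \<open>The column space meets the kernel of \<open>transpose A\<close> only in 0. This
    is why \<open>l\<close> is positive.\<close>
  have "?T *v u \<noteq> 0"
  proof
    assume 0: "?T *v u = 0"
    obtain x where x: "u = A *v x" using uV by auto
    have "u \<bullet> u = (?T *v u) \<bullet> x"
      by (simp only: inner_transpose_mult) (simp add: x)
    then show False using 0 u1 by simp
  qed
  then have "l > 0" by (simp add: l_def)
  \<comment> \<open>The residual of the eigenvalue equation. It lies in the column space, so it is
    an admissible direction for perturbing the minimiser \<open>u\<close>.\<close>
  define w where "w = A *v (?T *v u) - l *\<^sub>R u"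
  have wV: "w \<in> ?V"
    unfolding w_def by (intro subspace_diff[OF V] subspace_scale[OF V] uV rangeI)
  \<comment> \<open>Expands \<open>bound\<close> at \<open>u + t *\<^sub>R w\<close>: the terms in
    \<open>u \<bullet> w\<close> cancel, and the remaining linear coefficient must vanish, forcing
    \<open>w = 0\<close>.\<close>
  have "0 \<le> t * (2 * (w \<bullet> w)) + t\<^sup>2 * ((norm (?T *v w))\<^sup>2 - l * (norm w)\<^sup>2)" for t
  proof -
    have ww: "(?T *v u) \<bullet> (?T *v w) = w \<bullet> w + l * (u \<bullet> w)"
    proof -
      have "(?T *v u) \<bullet> (?T *v w) = w \<bullet> (A *v (?T *v u))"
        by (metis inner_commute inner_transpose_mult)
      also have "A *v (?T *v u) = w + l *\<^sub>R u"
        by (simp add: w_def)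
      finally show ?thesis
        by (simp add: inner_add_right inner_commute)
    qed
    have "0 \<le> (norm (?T *v (u + t *\<^sub>R w)))\<^sup>2 - l * (norm (u + t *\<^sub>R w))\<^sup>2"
      using bound[of "u + t *\<^sub>R w"] uV wV by (simp add: subspace_add[OF V] subspace_scale[OF V])
    also have "(norm (?T *v (u + t *\<^sub>R w)))\<^sup>2 =
        l + 2 * t * ((?T *v u) \<bullet> (?T *v w)) + t\<^sup>2 * (norm (?T *v w))\<^sup>2"
      unfolding l_def power2_norm_eq_inner
      by (simp add: matrix_vector_right_distrib matrix_vector_mult_scaleR inner_add_left
          inner_add_right inner_commute power2_eq_square algebra_simps)
    also have "(norm (u + t *\<^sub>R w))\<^sup>2 = 1 + 2 * t * (u \<bullet> w) + t\<^sup>2 * (norm w)\<^sup>2"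
      using u1 unfolding power2_norm_eq_inner norm_eq_1
      by (simp add: inner_add_left inner_add_right inner_commute power2_eq_square algebra_simps)
    finally show ?thesis unfolding ww by (simp add: algebra_simps del: transpose_matrix_vector)
  qed
  then have "2 * (w \<bullet> w) = 0" by (rule linear_coefficient_eq_0)
  then have "A *v (?T *v u) = l *\<^sub>R u" by (simp add: w_def)
  then show ?thesis
    by (rule that[OF uV u1 \<open>l > 0\<close> _ l_def[symmetric] bound])
qed

text \<open>\<open>A\<close> and \<open>transpose A\<close> carry eigenvectors with nonzero
  eigenvalue of one Gram matrix to those of the other. Hence the Rayleigh minimum \<open>l\<close>
  is the least nonzero eigenvalue of \<open>transpose A ** A\<close>, and the \<open>LEAST\<close>
  in \<open>sigma_min\<close> is attained at \<open>sqrt l\<close>.\<close>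

lemma sigma_min_props:
  fixes A :: "real ^ 'n ^ 'm"
  assumes "A \<noteq> 0"
  shows sigma_min_pos: "sigma_min A > 0"
    and sigma_min_le_norm: "sigma_min A \<le> norm A"
    and sigma_min_mult_norm_le: "w \<in> range ((*v) A) \<Longrightarrow>
      (sigma_min A)\<^sup>2 * (norm w)\<^sup>2 \<le> (norm (transpose A *v w))\<^sup>2"
proof -
  let ?T = "transpose A"
  obtain u l where u: "u \<in> range ((*v) A)" "norm u = 1" "l > 0"
    "A *v (?T *v u) = l *\<^sub>R u" "(norm (?T *v u))\<^sup>2 = l"
    and bound: "\<And>w. w \<in> range ((*v) A) \<Longrightarrow> l * (norm w)\<^sup>2 \<le> (norm (?T *v w))\<^sup>2"
    using rayleigh_minimiser_exists[OF assms] by metis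
  have "singular_value A (sqrt l)"
    unfolding singular_value_def
  proof (intro conjI exI)
    show "?T *v u \<noteq> 0" using u by auto
    show "(?T ** A) *v (?T *v u) = (sqrt l)\<^sup>2 *\<^sub>R (?T *v u)"
      using u by (simp add: matrix_vector_mult_scaleR flip: matrix_vector_mul_assoc)
  qed (use u in simp)
  moreover have "sqrt l \<le> s" if sv: "singular_value A s" "s \<noteq> 0" for s
  proof -
    obtain v where s: "s \<ge> 0" and v: "v \<noteq> 0" "?T *v (A *v v) = s\<^sup>2 *\<^sub>R v"
      using sv unfolding singular_value_def matrix_vector_mul_assoc[symmetric] by blast
    define w where "w = A *v v"
    have w: "w \<noteq> 0" using v sv by (auto simp: w_def)
    have "l * (norm w)\<^sup>2 \<le> (?T *v w) \<bullet> (?T *v w)"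
      using bound[of w] by (simp add: w_def power2_norm_eq_inner)
    also have "\<dots> = s\<^sup>2 * (norm w)\<^sup>2"
      by (simp only: inner_transpose_mult)
        (simp add: v w_def matrix_vector_mult_scaleR power2_norm_eq_inner
          del: transpose_matrix_vector)
    finally have "l \<le> s\<^sup>2" using w by simp
    then show ?thesis using s by (simp add: real_le_lsqrt)
  qed
  ultimately have sigma: "sigma_min A = sqrt l"
    unfolding sigma_min_def using u by (intro Least_equality) auto
  show "sigma_min A > 0" using u sigma by simp
  show "(sigma_min A)\<^sup>2 * (norm w)\<^sup>2 \<le> (norm (?T *v w))\<^sup>2" if "w \<in> range ((*v) A)"
    using bound[OF that] u sigma by simp
  \<comment> \<open>As \<open>u\<close> is a unit vector, Cauchy-Schwarz on each column bounds
    \<open>l\<close>, the sum of these squares, by the squared Frobenius norm.\<close>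
  have "(column j A \<bullet> u)\<^sup>2 \<le> (norm (column j A))\<^sup>2" for j
    using Cauchy_Schwarz_ineq[of "column j A" u] u(2) by (simp add: power2_norm_eq_inner norm_eq_1)
  then have "l \<le> (norm A)\<^sup>2"
    using u(5) unfolding norm_transpose_mult norm_matrix_eq_sum_columns by (auto intro: sum_mono)
  then show "sigma_min A \<le> norm A"
    unfolding sigma by (intro real_le_lsqrt) auto
qed

section \<open>The iteration\<close>

text \<open>Pythagoras; for \<open>a = 0\<close> both sides reduce to
  \<open>(norm x)\<^sup>2\<close> because division by zero yields 0.\<close>

lemma norm_diff_projection:
  fixes x a :: "'a :: real_inner"
  shows "(norm (x - (x \<bullet> a / (norm a)\<^sup>2) *\<^sub>R a))\<^sup>2 = (norm x)\<^sup>2 - (x \<bullet> a)\<^sup>2 / (norm a)\<^sup>2"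
proof -
  have "(norm (x - c *\<^sub>R a))\<^sup>2 = (norm x)\<^sup>2 - 2 * c * (x \<bullet> a) + c\<^sup>2 * (norm a)\<^sup>2" for c
    unfolding power2_norm_eq_inner
    by (simp add: inner_diff_left inner_diff_right inner_commute power2_eq_square algebra_simps)
  from this[of "x \<bullet> a / (norm a)\<^sup>2"] show ?thesis
    by (cases "a = 0") (simp_all add: divide_simps power2_eq_square)
qed

lemma kaczmarz_step_error_row:
  assumes "S ** A = C"
  shows "(kaczmarz_step A C j X - S) $ i =
    (X - S) $ i - ((X - S) $ i \<bullet> column j A / (norm (column j A))\<^sup>2) *\<^sub>R column j A"
proof -
  \<comment> \<open>Turns the residual of the step into \<open>- (X - S) *v column j A\<close>, so
    the new error depends on the old error alone.\<close>
  have "column j C = S *v column j A"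
    using assms by (metis matrix_vector_mul_assoc matrix_vector_mult_basis)
  then show ?thesis
    by (simp add: kaczmarz_step_def outer_product_def vec_eq_iff matrix_vector_mult_def
        inner_vec_def sum_subtractf left_diff_distrib divide_inverse algebra_simps)
qed

lemma kaczmarz_step_error_norm:
  assumes "S ** A = C"
  shows "(norm (kaczmarz_step A C j X - S))\<^sup>2 =
    (norm (X - S))\<^sup>2 - (norm ((X - S) *v column j A))\<^sup>2 / (norm (column j A))\<^sup>2"
proof -
  have "(norm ((X - S) *v column j A))\<^sup>2 = (\<Sum>i\<in>UNIV. ((X - S) $ i \<bullet> column j A)\<^sup>2)"
    by (simp add: norm_vec_def L2_set_def sum_nonneg matrix_vector_mult_def inner_vec_def)
  then show ?thesis
    unfolding norm_matrix_eq_sum_rows kaczmarz_step_error_row[OF assms] norm_diff_projection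
    by (simp add: sum_subtractf sum_divide_distrib)
qed

text \<open>The invariant that keeps the error where \<open>sigma_min_mult_norm_le\<close> applies;
  that bound fails for nonzero vectors orthogonal to the column space.\<close>

definition rows_in_range :: "real ^ 'n ^ 'm \<Rightarrow> real ^ 'm ^ 'p \<Rightarrow> bool" where
  "rows_in_range A E \<longleftrightarrow> (\<forall>i. E $ i \<in> range ((*v) A))"

lemma rows_in_range_kaczmarz_step:
  assumes "S ** A = C" "rows_in_range A (X - S)"
  shows "rows_in_range A (kaczmarz_step A C j X - S)"
proof -
  have "column j A \<in> range ((*v) A)"
    by (metis matrix_vector_mult_basis rangeI)
  then show ?thesis
    using assms(2) unfolding rows_in_range_def kaczmarz_step_error_row[OF assms(1)]
    by (intro allI subspace_diff subspace_scale subspace_range_matrix) auto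
qed

lemma mean_step_error_le:
  fixes A :: "real ^ 'n ^ 'm" and E :: "real ^ 'm ^ 'p"
  assumes "A \<noteq> 0" "rows_in_range A E"
  shows "(\<Sum>j\<in>UNIV. (norm (column j A))\<^sup>2 / (norm A)\<^sup>2 *
      ((norm E)\<^sup>2 - (norm (E *v column j A))\<^sup>2 / (norm (column j A))\<^sup>2))
    \<le> (1 - (sigma_min A)\<^sup>2 / (norm A)\<^sup>2) * (norm E)\<^sup>2"
proof -
  \<comment> \<open>The weights cancel the denominators. A zero column contributes 0 to both
    sums.\<close>
  have "(\<Sum>j\<in>UNIV. (norm (column j A))\<^sup>2 / (norm A)\<^sup>2 *
      ((norm E)\<^sup>2 - (norm (E *v column j A))\<^sup>2 / (norm (column j A))\<^sup>2))
    = (\<Sum>j\<in>UNIV. (norm (column j A))\<^sup>2 * ((norm E)\<^sup>2 / (norm A)\<^sup>2)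
        - (norm (E *v column j A))\<^sup>2 / (norm A)\<^sup>2)"
    using assms(1) by (intro sum.cong refl) (auto simp: field_simps)
  also have "\<dots> = (norm E)\<^sup>2 - (\<Sum>j\<in>UNIV. (norm (E *v column j A))\<^sup>2) / (norm A)\<^sup>2"
    unfolding sum_subtractf sum_distrib_right[symmetric] norm_matrix_eq_sum_columns[symmetric]
    using assms(1) by (simp add: sum_divide_distrib)
  \<comment> \<open>Regroups the squared norm of \<open>E ** A\<close> by rows, because the singular
    value bound concerns a single row.\<close>
  also have "(\<Sum>j\<in>UNIV. (norm (E *v column j A))\<^sup>2) =
      (\<Sum>j\<in>UNIV. \<Sum>i\<in>UNIV. (column j A \<bullet> E $ i)\<^sup>2)"
    by (simp add: norm_vec_def L2_set_def sum_nonneg matrix_vector_mult_def inner_vec_def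
        mult.commute)
  also have "\<dots> = (\<Sum>i\<in>UNIV. (norm (transpose A *v (E $ i)))\<^sup>2)"
    unfolding norm_transpose_mult by (rule sum.swap)
  also have "(norm E)\<^sup>2 - \<dots> / (norm A)\<^sup>2 \<le>
      (norm E)\<^sup>2 - (\<Sum>i\<in>UNIV. (sigma_min A)\<^sup>2 * (norm (E $ i))\<^sup>2) / (norm A)\<^sup>2"
    using assms
    by (intro diff_left_mono divide_right_mono sum_mono sigma_min_mult_norm_le)
      (auto simp: rows_in_range_def)
  also have "\<dots> = (1 - (sigma_min A)\<^sup>2 / (norm A)\<^sup>2) * (norm E)\<^sup>2"
    by (simp add: left_diff_distrib flip: sum_distrib_left norm_matrix_eq_sum_rows)
  finally show ?thesis .
qed

section \<open>The iterate as a function of the index sequence: measurability and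
  independence\<close>

primrec kaczmarz_iterate ::
  "real ^ 'n ^ 'm \<Rightarrow> real ^ 'n ^ 'p \<Rightarrow> real ^ 'm ^ 'p \<Rightarrow> (nat \<Rightarrow> 'n) \<Rightarrow> nat \<Rightarrow> real ^ 'm ^ 'p" where
  "kaczmarz_iterate A C X0 js 0 = X0"
| "kaczmarz_iterate A C X0 js (Suc k) = kaczmarz_step A C (js k) (kaczmarz_iterate A C X0 js k)"

text \<open>Serves to make iterate \<open>k\<close> a function of the past indices only, hence
  independent of index \<open>k\<close>.\<close>

lemma kaczmarz_iterate_cong:
  "(\<And>i. i < k \<Longrightarrow> js i = js' i) \<Longrightarrow> kaczmarz_iterate A C X0 js k = kaczmarz_iterate A C X0 js' k"
  by (induction k) auto

lemma measurable_kaczmarz_step [measurable]: "kaczmarz_step A C j \<in> borel_measurable borel"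
proof -
  have "continuous_on UNIV (kaczmarz_step A C j)"
    unfolding kaczmarz_step_def outer_product_def matrix_vector_mult_def
    by (intro continuous_intros)
  then show ?thesis by (rule borel_measurable_continuous_onI)
qed

lemma measurable_kaczmarz_iterate:
  fixes A :: "real ^ 'n ^ 'm"
  assumes "{..<k} \<subseteq> I"
  shows "(\<lambda>js. kaczmarz_iterate A C X0 js k) \<in> borel_measurable (PiM I (\<lambda>_. count_space UNIV))"
  using assms
proof (induction k)
  case (Suc k)
  have IH [measurable]:
    "(\<lambda>js. kaczmarz_iterate A C X0 js k) \<in> borel_measurable (PiM I (\<lambda>_. count_space UNIV))"
    by (rule Suc.IH) (use Suc.prems in auto)
  have k: "(\<lambda>js. js k) \<in> PiM I (\<lambda>_. count_space UNIV) \<rightarrow>\<^sub>M count_space (UNIV :: 'n set)"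
    using Suc.prems by (intro measurable_component_singleton) auto
  \<comment> \<open>The index takes finitely many values, so measurability reduces to the step with
    a fixed column.\<close>
  show ?case
    unfolding kaczmarz_iterate.simps
    by (rule measurable_compose_countable'[OF _ k]) (measurable, use Suc.prems in \<open>auto intro: countable_finite\<close>)
qed simp

text \<open>The real-valued \<open>f\<close> and \<open>g\<close> are there because \<open>indep_var\<close> requires both variables to have the
  same codomain type.\<close>

lemma (in prob_space)
  assumes J: "indep_vars (\<lambda>_. count_space UNIV) J UNIV"
  shows random_variable_kaczmarz_iterate:
      "random_variable borel (\<lambda>\<omega>. kaczmarz_iterate A C X0 (\<lambda>i. J i \<omega>) k)"
    and indep_var_kaczmarz_iterate: "f \<in> borel_measurable borel \<Longrightarrow>
      indep_var borel (\<lambda>\<omega>. g (J k \<omega>) :: real)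
        borel (\<lambda>\<omega>. f (kaczmarz_iterate A C X0 (\<lambda>i. J i \<omega>) k) :: real)"
proof -
  have iterate: "kaczmarz_iterate A C X0 (restrict (\<lambda>i. J i \<omega>) {..<k}) k =
      kaczmarz_iterate A C X0 (\<lambda>i. J i \<omega>) k" for \<omega>
    by (rule kaczmarz_iterate_cong) simp
  let ?past = "\<lambda>\<omega>. restrict (\<lambda>i. J i \<omega>) {..<k}" and ?present = "\<lambda>\<omega>. restrict (\<lambda>i. J i \<omega>) {k}"
  \<comment> \<open>Index \<open>k\<close> drives the step from iterate \<open>k\<close> to
    \<open>Suc k\<close>, so it is disjoint from the block \<open>{..<k}\<close> that determines
    iterate \<open>k\<close>.\<close>
  have ind: "indep_var (PiM {k} (\<lambda>_. count_space UNIV)) ?present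
      (PiM {..<k} (\<lambda>_. count_space UNIV)) ?past"
    by (rule indep_var_restrict[OF J]) auto
  note [measurable] = measurable_kaczmarz_iterate[of k "{..<k}", simplified]
  have "(\<lambda>js. kaczmarz_iterate A C X0 js k) \<circ> ?past \<in> borel_measurable M"
    by (rule measurable_comp[OF indep_var_rv2[OF ind]]) measurable
  then show "random_variable borel (\<lambda>\<omega>. kaczmarz_iterate A C X0 (\<lambda>i. J i \<omega>) k)"
    by (simp add: comp_def iterate)
  assume [measurable]: "f \<in> borel_measurable borel"
  have "indep_var borel ((\<lambda>js. g (js k)) \<circ> ?present)
      borel ((\<lambda>js. f (kaczmarz_iterate A C X0 js k)) \<circ> ?past)"
    by (rule indep_var_compose[OF ind]) measurable
  then show "indep_var borel (\<lambda>\<omega>. g (J k \<omega>) :: real)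
        borel (\<lambda>\<omega>. f (kaczmarz_iterate A C X0 (\<lambda>i. J i \<omega>) k) :: real)"
    by (simp add: comp_def iterate)
qed

text \<open>Both claims hold along every index sequence; the uniform norm bound later supplies
  integrability.\<close>

lemma kaczmarz_iterate_error:
  assumes "S ** A = C" "rows_in_range A (X0 - S)"
  shows rows_in_range_kaczmarz_iterate: "rows_in_range A (kaczmarz_iterate A C X0 js k - S)"
    and norm_kaczmarz_iterate_error_le: "norm (kaczmarz_iterate A C X0 js k - S) \<le> norm (X0 - S)"
proof -
  show "rows_in_range A (kaczmarz_iterate A C X0 js k - S)"
    by (induction k) (auto intro!: rows_in_range_kaczmarz_step assms)
  have "(norm (kaczmarz_step A C j X - S))\<^sup>2 \<le> (norm (X - S))\<^sup>2" for j X
    unfolding kaczmarz_step_error_norm[OF assms(1)] by simp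
  then have "norm (kaczmarz_step A C j X - S) \<le> norm (X - S)" for j X
    using power2_le_imp_le norm_ge_zero by blast
  then show "norm (kaczmarz_iterate A C X0 js k - S) \<le> norm (X0 - S)"
    by (induction k) (auto intro: order_trans)
qed

section \<open>Contraction of the expected squared error\<close>

context prob_space
begin

context
  fixes A :: "real ^ 'n ^ 'm" and C :: "real ^ 'n ^ 'p" and X0 S :: "real ^ 'm ^ 'p"
    and J :: "nat \<Rightarrow> 'a \<Rightarrow> 'n" and Y :: "nat \<Rightarrow> 'a \<Rightarrow> real ^ 'm ^ 'p"
  assumes A: "A \<noteq> 0" and S: "S ** A = C" "rows_in_range A (X0 - S)"
    and indep: "indep_vars (\<lambda>_. count_space UNIV) J UNIV"
    and prob: "\<And>k j. prob {\<omega> \<in> space M. J k \<omega> = j} = (norm (column j A))\<^sup>2 / (norm A)\<^sup>2"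
  defines "Y \<equiv> \<lambda>k \<omega>. kaczmarz_iterate A C X0 (\<lambda>i. J i \<omega>) k"
begin

lemma measurable_iterates [measurable]: "Y k \<in> borel_measurable M"
  using random_variable_kaczmarz_iterate[OF indep] unfolding Y_def .

lemma integrable_norm_error: "integrable M (\<lambda>\<omega>. (norm (Y k \<omega> - S))\<^sup>2)"
proof (rule integrable_const_bound[where B = "(norm (X0 - S))\<^sup>2"])
  show "AE \<omega> in M. norm ((norm (Y k \<omega> - S))\<^sup>2) \<le> (norm (X0 - S))\<^sup>2"
    using norm_kaczmarz_iterate_error_le[OF S] by (auto simp: Y_def intro!: power_mono)
qed measurable

text \<open>Conditioning on index \<open>k\<close> is done by hand: the error is split over the
  events \<open>J k = j\<close>, independence factors each expectation, and the resulting average is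
  bounded pointwise by \<open>mean_step_error_le\<close>.\<close>

lemma expectation_norm_error_Suc:
  "expectation (\<lambda>\<omega>. (norm (Y (Suc k) \<omega> - S))\<^sup>2)
    \<le> (1 - (sigma_min A)\<^sup>2 / (norm A)\<^sup>2) * expectation (\<lambda>\<omega>. (norm (Y k \<omega> - S))\<^sup>2)"
proof -
  define p where "p j = (norm (column j A))\<^sup>2 / (norm A)\<^sup>2" for j
  define g where "g j X = (norm (kaczmarz_step A C j X - S))\<^sup>2" for j X
  have [measurable]: "g j \<in> borel_measurable borel" for j
    unfolding g_def by measurable
  have g: "g j X = (norm (X - S))\<^sup>2 - (norm ((X - S) *v column j A))\<^sup>2 / (norm (column j A))\<^sup>2"
    for j X
    unfolding g_def by (rule kaczmarz_step_error_norm[OF S(1)])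
  have g_bounds: "0 \<le> g j X" "g j X \<le> (norm (X - S))\<^sup>2" for j X
    by (simp add: g_def) (simp add: g)
  have [measurable]: "J k \<in> M \<rightarrow>\<^sub>M count_space UNIV"
    using indep by (simp add: indep_vars_def2)
  have int_g: "integrable M (\<lambda>\<omega>. g j (Y k \<omega>))" for j
  proof (rule Bochner_Integration.integrable_bound[OF integrable_norm_error])
    show "AE \<omega> in M. norm (g j (Y k \<omega>)) \<le> norm ((norm (Y k \<omega> - S))\<^sup>2)"
      using g_bounds by simp
  qed measurable
  have int_ind: "integrable M (\<lambda>\<omega>. indicat_real {j} (J k \<omega>))" for j
    by (rule integrable_const_bound[where B = 1]) (auto simp: indicator_def)
  have indep_g: "indep_var borel (\<lambda>\<omega>. indicat_real {j} (J k \<omega>)) borel (\<lambda>\<omega>. g j (Y k \<omega>))" for j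
    unfolding Y_def by (rule indep_var_kaczmarz_iterate[OF indep]) measurable
  have "expectation (\<lambda>\<omega>. indicat_real {j} (J k \<omega>)) = p j" for j
  proof -
    have "expectation (\<lambda>\<omega>. indicat_real {j} (J k \<omega>)) =
        expectation (indicat_real {\<omega> \<in> space M. J k \<omega> = j})"
      by (intro Bochner_Integration.integral_cong) (auto simp: indicator_def)
    then show ?thesis by (simp add: prob p_def)
  qed
  then have E: "expectation (\<lambda>\<omega>. indicat_real {j} (J k \<omega>) * g j (Y k \<omega>)) =
      p j * expectation (\<lambda>\<omega>. g j (Y k \<omega>))" for j
    by (simp add: indep_var_lebesgue_integral[OF indep_g int_ind int_g])
  have "(norm (Y (Suc k) \<omega> - S))\<^sup>2 = (\<Sum>j\<in>UNIV. indicat_real {j} (J k \<omega>) * g j (Y k \<omega>))" for \<omega>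
    by (simp add: Y_def g_def indicator_def if_distrib[of "\<lambda>x. x * _"] cong: if_cong)
  then have "expectation (\<lambda>\<omega>. (norm (Y (Suc k) \<omega> - S))\<^sup>2) =
      (\<Sum>j\<in>UNIV. p j * expectation (\<lambda>\<omega>. g j (Y k \<omega>)))"
    by (simp only: E Bochner_Integration.integral_sum[OF indep_var_integrable[OF indep_g int_ind int_g]])
  \<comment> \<open>Returns to a single expectation, so that the one-step bound applies at each
    outcome.\<close>
  also have "\<dots> = expectation (\<lambda>\<omega>. \<Sum>j\<in>UNIV. p j * g j (Y k \<omega>))"
    using int_g by simp
  also have "\<dots> \<le> expectation (\<lambda>\<omega>. (1 - (sigma_min A)\<^sup>2 / (norm A)\<^sup>2) * (norm (Y k \<omega> - S))\<^sup>2)"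
  proof (rule integral_mono)
    show "(\<Sum>j\<in>UNIV. p j * g j (Y k \<omega>)) \<le>
        (1 - (sigma_min A)\<^sup>2 / (norm A)\<^sup>2) * (norm (Y k \<omega> - S))\<^sup>2" for \<omega>
      unfolding g p_def Y_def
      by (intro mean_step_error_le[OF A] rows_in_range_kaczmarz_iterate[OF S])
  qed (use int_g integrable_norm_error in auto)
  finally show ?thesis by simp
qed

lemma expectation_norm_error_le:
  "expectation (\<lambda>\<omega>. (norm (Y k \<omega> - S))\<^sup>2)
    \<le> (1 - (sigma_min A)\<^sup>2 / (norm A)\<^sup>2) ^ k * (norm (X0 - S))\<^sup>2"
proof (induction k)
  case 0
  then show ?case by (simp add: Y_def prob_space)
next
  case (Suc k)
  \<comment> \<open>Multiplying the induction hypothesis by the contraction factor requires the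
    factor to be nonnegative.\<close>
  have "(sigma_min A)\<^sup>2 / (norm A)\<^sup>2 \<le> 1"
    using A sigma_min_pos[OF A] sigma_min_le_norm[OF A] by (simp add: power_mono)
  with Suc show ?case
    by (intro order_trans[OF expectation_norm_error_Suc]) (simp add: mult_left_mono mult.assoc)
qed

end

end

section \<open>The limit solves the equation, and its initial error lies in the right
  subspace\<close>

lemma moore_penrose_solution:
  fixes A :: "real ^ 'n ^ 'm" and C :: "real ^ 'n ^ 'p" and X0 :: "real ^ 'm ^ 'p"
  assumes "\<exists>Y :: real ^ 'm ^ 'p. Y ** A = C"
    and S: "S = C ** moore_penrose_inverse A + X0 ** (mat 1 - A ** moore_penrose_inverse A)"
  shows "S ** A = C" "rows_in_range A (X0 - S)"
proof -
  let ?P = "moore_penrose_inverse A"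
  have P: "A ** ?P ** A = A" "?P ** A ** ?P = ?P" "transpose (A ** ?P) = A ** ?P"
    using is_moore_penrose_inverse[of A] unfolding is_moore_penrose_inverse_def by auto
  obtain Y :: "real ^ 'm ^ 'p" where Y: "Y ** A = C" using assms by auto
  have "C ** ?P ** A = C"
    by (metis P(1) Y matrix_mul_assoc)
  moreover have "(mat 1 - A ** ?P) ** A = 0"
    by (simp add: P matrix_diff_rdistrib)
  ultimately show "S ** A = C"
    by (simp add: S matrix_add_rdistrib flip: matrix_mul_assoc)
  have "X0 - S = (X0 ** A - C) ** ?P"
    by (simp add: S matrix_diff_ldistrib matrix_diff_rdistrib matrix_mul_assoc)
  \<comment> \<open>From \<open>?P = ?P ** (A ** ?P)\<close> and the symmetry of
    \<open>A ** ?P\<close>. The trailing \<open>transpose A\<close> puts the rows of the error in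
    the column space.\<close>
  also have "?P = ?P ** transpose ?P ** transpose A"
    by (metis P matrix_mul_assoc matrix_transpose_mul)
  finally obtain B where B: "X0 - S = B ** transpose A"
    by (metis matrix_mul_assoc)
  have "(X0 - S) $ i = A *v (B $ i)" for i
    unfolding B by (simp add: vec_eq_iff matrix_matrix_mult_def matrix_vector_mult_def transpose_def
        mult.commute)
  then show "rows_in_range A (X0 - S)"
    unfolding rows_in_range_def by auto
qed

theorem theorem2p4:
  fixes A :: "real ^ 'n ^ 'm" and C :: "real ^ 'n ^ 'p"
    and X0 Xstar :: "real ^ 'm ^ 'p"
    and M :: "'w measure" and J :: "nat \<Rightarrow> 'w \<Rightarrow> 'n"
    and X :: "nat \<Rightarrow> 'w \<Rightarrow> real ^ 'm ^ 'p"
  assumes "A \<noteq> 0"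
    and consistent: "\<exists>Y :: real ^ 'm ^ 'p. Y ** A = C"
    and "prob_space M"
    and indep: "prob_space.indep_vars M (\<lambda>_. count_space UNIV) J UNIV"
    and prob: "\<And>k j. measure M {\<omega> \<in> space M. J k \<omega> = j} = (norm (column j A))\<^sup>2 / (norm A)\<^sup>2"
    and init: "\<And>\<omega>. \<omega> \<in> space M \<Longrightarrow> X 0 \<omega> = X0"
    and step: "\<And>k \<omega>. \<omega> \<in> space M \<Longrightarrow> X (Suc k) \<omega> = kaczmarz_step A C (J k \<omega>) (X k \<omega>)"
    and Xstar: "Xstar = C ** moore_penrose_inverse A + X0 ** (mat 1 - A ** moore_penrose_inverse A)"
  shows "converges_linearly_in_mean_square M X Xstar \<and>
    (\<forall>k. (LINT \<omega>|M. (norm (X k \<omega> - Xstar))\<^sup>2)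
       \<le> (1 - (sigma_min A)\<^sup>2 / (norm A)\<^sup>2) ^ k * (norm (X0 - Xstar))\<^sup>2)"
proof -
  interpret prob_space M by fact
  note S = moore_penrose_solution[OF consistent Xstar]
  \<comment> \<open>The recursion is given on \<open>space M\<close> only, so the integrals below
    are transferred by congruence on that set.\<close>
  have X: "X k \<omega> = kaczmarz_iterate A C X0 (\<lambda>i. J i \<omega>) k" if "\<omega> \<in> space M" for k \<omega>
    by (induction k) (simp_all add: init step that)
  let ?q = "1 - (sigma_min A)\<^sup>2 / (norm A)\<^sup>2"
  have int: "integrable M (\<lambda>\<omega>. (norm (X k \<omega> - Xstar))\<^sup>2)" for k
    using integrable_norm_error[OF \<open>A \<noteq> 0\<close> S indep prob, of k]
    by (rule Bochner_Integration.integrable_cong[THEN iffD1, rotated -1]) (simp_all add: X)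
  have le: "(LINT \<omega>|M. (norm (X k \<omega> - Xstar))\<^sup>2) \<le> ?q ^ k * (norm (X0 - Xstar))\<^sup>2" for k
    using expectation_norm_error_le[OF \<open>A \<noteq> 0\<close> S indep prob, of k]
    by (simp add: X cong: Bochner_Integration.integral_cong)
  \<comment> \<open>Nonnegativity comes from \<open>sigma_min_le_norm\<close>, strictness from
    \<open>sigma_min_pos\<close>.\<close>
  have "0 \<le> ?q" "?q < 1"
    using \<open>A \<noteq> 0\<close> sigma_min_pos[of A] sigma_min_le_norm[of A] by (simp_all add: power_mono)
  then have "converges_linearly_in_mean_square M X Xstar"
    unfolding converges_linearly_in_mean_square_def using int le
    by (intro conjI allI exI[of _ "(norm (X0 - Xstar))\<^sup>2"] exI[of _ ?q]) (auto simp: mult.commute)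
  then show ?thesis using le by blast
qed

end
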